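(* Consider a transformer composed of $L$ layers with (1) output weights $\mathbf{H}\in\mathbb{R}^{m\times d}$, (2) self-attention weights: combined key-query weights $(\mathbf{W}_i)_{i=1}^L\in\mathbb{R}^{d\times d}$ and value weights $(\mathbf{V}_i)_{i=1}^L\in\mathbb{R}^{d\times d}$, (3) MLP weights $(\mathbf{M}^{(i)}_j)_{i=1,j=1}^{L,m}\in\mathbb{R}^{d\times d}$ and activation $\phi\in\{\text{ReLU},\text{Identity}\}$. For some $\Gamma>0$, assume $\|\mathbf{V}_i\|\leq 1,\|\mathbf{M}^{(i)}_j\|\leq 1, \|\mathbf{W}_i\|\leq \Gamma/2$ and $\|\mathbf{H}\|_{2,\infty}\leq c/m$. Suppose the input is $\mathcal{S}=(\mathbf{z}_1,\dots,\mathbf{z}_m)$ with $\|\mathbf{z}_i\|_2\leq 1$. The model prediction is given by $\mathcal{S}_{(0)}=\mathcal{S}$, layer $i$ outputs $\mathcal{S}_{(i)}=\texttt{Parallel\_MLP}_{\mathbf{M}^{(i)}}(\texttt{Att}_{\mathbf{W}_i,\mathbf{V}_i}(\mathcal{S}_{(i-1)}))$, where $\texttt{Att}_{\mathbf{W}_i,\mathbf{V}_i}(\mathcal{S})=\mathrm{softmax}(\mathcal{S}^\top \mathbf{W}_i \mathcal{S}) \mathcal{S}\mathbf{V}_i$ (row-wise softmax) and $\texttt{Parallel\_MLP}$ applies $\mathbf{x}\mapsto\phi(\mathbf{M}^{(i)}_{j}\mathbf{x})$ to the $j$-th token of the attention output, and $\mathrm{TF}(\mathcal{S})=\langle\mathbf{H},\mathcal{S}_{(L)}\rangle$.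 Then, first, this model is properly normalized in the sense that it can attain $\mathrm{TF}(\mathcal{S})=\pm c$. Second, this model obeys the stability guarantee \[ |\mathrm{TF}(\mathcal{S})-\mathrm{TF}(\mathcal{S}')|\leq \frac{c}{m}((1+\Gamma)e^\Gamma)^L \|\mathcal{S}-\mathcal{S}'\|_{2,1} \] for any two such inputs $\mathcal{S},\mathcal{S}'$.
   Context: For a matrix $\mathbf{A}$, $\|\mathbf{A}\|_{2,p}$ denotes the $\ell_p$ norm of the vector of Euclidean norms of its rows. *)

theory Defs
  imports "HOL-Analysis.Analysis"
begin

text \<open>Tokens live in real^'d; a sequence of m tokens is indexed by the finite type 'm
  (so m = CARD('m)). A d x d matrix is real^'d^'d acting by *v.\<close>

datatype activation = ReLU | Identity

definition act :: "activation \<Rightarrow> real^'d \<Rightarrow> real^'d" where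
  "act \<phi> x = (case \<phi> of ReLU \<Rightarrow> (\<chi> k. max 0 (x $ k)) | Identity \<Rightarrow> x)"

definition attn :: "real^'d^'d \<Rightarrow> real^'d^'d \<Rightarrow> (real^'d)^'m \<Rightarrow> (real^'d)^'m" where
  "attn W V S = (\<chi> j. \<Sum>k\<in>UNIV.
      (exp (S$j \<bullet> (W *v S$k)) / (\<Sum>k'\<in>UNIV. exp (S$j \<bullet> (W *v S$k')))) *\<^sub>R (V *v S$k))"

definition parallel_mlp :: "activation \<Rightarrow> ('m \<Rightarrow> real^'d^'d) \<Rightarrow> (real^'d)^'m \<Rightarrow> (real^'d)^'m" where
  "parallel_mlp \<phi> M S = (\<chi> j. act \<phi> (M j *v S$j))"

fun layers :: "activation \<Rightarrow> (nat \<Rightarrow> real^'d^'d) \<Rightarrow> (nat \<Rightarrow> real^'d^'d)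
      \<Rightarrow> (nat \<Rightarrow> 'm \<Rightarrow> real^'d^'d) \<Rightarrow> nat \<Rightarrow> (real^'d)^'m \<Rightarrow> (real^'d)^'m" where
  "layers \<phi> W V M 0 S = S"
| "layers \<phi> W V M (Suc i) S =
     parallel_mlp \<phi> (M (Suc i)) (attn (W (Suc i)) (V (Suc i)) (layers \<phi> W V M i S))"

definition TF :: "activation \<Rightarrow> nat \<Rightarrow> (real^'d)^'m \<Rightarrow> (nat \<Rightarrow> real^'d^'d) \<Rightarrow> (nat \<Rightarrow> real^'d^'d)
      \<Rightarrow> (nat \<Rightarrow> 'm \<Rightarrow> real^'d^'d) \<Rightarrow> (real^'d)^'m \<Rightarrow> real" where
  "TF \<phi> L H W V M S = (\<Sum>j\<in>UNIV. H$j \<bullet> (layers \<phi> W V M L S)$j)"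

definition mat_norm :: "real^'d^'d \<Rightarrow> real" where
  "mat_norm A = onorm (\<lambda>x. A *v x)"

definition norm_2_inf :: "(real^'d)^'m \<Rightarrow> real" where
  "norm_2_inf A = Max (range (\<lambda>j. norm (A$j)))"

definition norm_2_1 :: "(real^'d)^'m \<Rightarrow> real" where
  "norm_2_1 A = (\<Sum>j\<in>UNIV. norm (A$j))"

definition admissible :: "real \<Rightarrow> real \<Rightarrow> nat \<Rightarrow> (real^'d)^'m \<Rightarrow> (nat \<Rightarrow> real^'d^'d)
      \<Rightarrow> (nat \<Rightarrow> real^'d^'d) \<Rightarrow> (nat \<Rightarrow> 'm \<Rightarrow> real^'d^'d) \<Rightarrow> bool" where
  "admissible \<Gamma> c L H W V M \<longleftrightarrow>
     (\<forall>i\<in>{1..L}. mat_norm (V i) \<le> 1 \<and> mat_norm (W i) \<le> \<Gamma> / 2 \<and>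
                 (\<forall>j. mat_norm (M i j) \<le> 1)) \<and>
     norm_2_inf H \<le> c / real CARD('m)"

definition valid_input :: "(real^'d)^'m \<Rightarrow> bool" where
  "valid_input S \<longleftrightarrow> (\<forall>j. norm (S$j) \<le> 1)"

end

theory Submission
  imports Defs
begin

text \<open>
  The attention map is \<open>(1 + \<Gamma>) exp \<Gamma>\<close>-Lipschitz in the \<open>(2,1)\<close> norm: the remaining
  operations of a layer are 1-Lipschitz and keep tokens in the unit ball. Along the segment
  between two inputs, with \<open>s\<^sub>j\<close> the \<open>j\<close>-th row of the softmax, \<open>\<mu>\<^sub>j\<close> and \<open>V\<^sub>j\<close> the mean and
  variance of the tokens \<open>z\<^sub>k\<close> under \<open>s\<^sub>j\<close>, the velocity of the \<open>j\<close>-th output token is at most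
  \<open>\<Sum>k. s\<^sub>j k |e\<^sub>k| (1 + \<Gamma>/2 |z\<^sub>k - \<mu>\<^sub>j|) + \<Gamma>/2 |e\<^sub>j| V\<^sub>j\<close>.
  The crude estimates \<open>s\<^sub>j k \<le> exp \<Gamma> / m\<close>, \<open>|z\<^sub>k - \<mu>\<^sub>j| \<le> 2\<close>, \<open>V\<^sub>j \<le> 1\<close> exceed the claimed
  constant by \<open>\<Gamma>/2\<close>. They cannot be sharp simultaneously: with \<open>V\<close> the variance of the tokens under the
  uniform distribution and \<open>E = exp (\<Gamma> - \<Gamma> V / 4)\<close>, Jensen's inequality gives
  \<open>s\<^sub>j k \<le> E / m\<close>, hence \<open>V\<^sub>j \<le> E V\<close>, while \<open>s\<^sub>j k \<ge> exp (- \<Gamma>) / m\<close> gives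
  \<open>|z\<^sub>k - \<mu>\<^sub>j| \<le> 2 - exp (- \<Gamma>) V / 2\<close>. The constant then follows from \<open>1 - \<Gamma> \<le> exp (- \<Gamma>)\<close>.
\<close>

section \<open>Softmax\<close>

definition softmax :: "('m::finite \<Rightarrow> real) \<Rightarrow> 'm \<Rightarrow> real" where
  "softmax a k = exp (a k) / (\<Sum>l\<in>UNIV. exp (a l))"

lemma sum_exp_pos: "0 < (\<Sum>l\<in>UNIV. exp (a l))" for a :: "'m::finite \<Rightarrow> real"
  by (intro sum_pos) auto

lemma softmax_nonneg: "0 \<le> softmax a k"
  unfolding softmax_def by (intro divide_nonneg_pos sum_exp_pos) auto

lemma sum_softmax: "(\<Sum>k\<in>UNIV. softmax a k) = 1"
  unfolding softmax_def sum_divide_distrib[symmetric] using sum_exp_pos[of a] by simp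

lemma softmax_le:
  fixes a :: "'m::finite \<Rightarrow> real"
  shows "softmax a k \<le> exp (a k - (\<Sum>l\<in>UNIV. a l) / CARD('m)) / CARD('m)"
proof -
  define b where "b = (\<Sum>l\<in>UNIV. a l) / CARD('m)"
  have "real CARD('m) = (\<Sum>l\<in>UNIV. 1 + (a l - b))"
    by (simp add: sum.distrib sum_subtractf b_def)
  also have "\<dots> \<le> (\<Sum>l\<in>UNIV. exp (a l - b))"
    by (intro sum_mono exp_ge_add_one_self)
  also have "\<dots> = (\<Sum>l\<in>UNIV. exp (a l)) / exp b"
    by (simp add: exp_diff sum_divide_distrib)
  finally have "CARD('m) * exp b \<le> (\<Sum>l\<in>UNIV. exp (a l))"
    by (simp add: field_simps)
  hence "softmax a k \<le> exp (a k) / (CARD('m) * exp b)"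
    unfolding softmax_def by (intro divide_left_mono mult_pos_pos sum_exp_pos) auto
  thus ?thesis by (simp add: exp_diff mult.commute flip: b_def)
qed

lemma softmax_ge:
  fixes a :: "'m::finite \<Rightarrow> real"
  assumes "\<And>l. \<bar>a l\<bar> \<le> r / 2"
  shows "exp (- r) / CARD('m) \<le> softmax a k"
proof -
  have "(\<Sum>l\<in>UNIV. exp (a l)) \<le> (\<Sum>l\<in>(UNIV::'m set). exp (r / 2))"
    using abs_le_D1[OF assms] by (intro sum_mono) simp
  hence *: "(\<Sum>l\<in>UNIV. exp (a l)) \<le> CARD('m) * exp (r / 2)" by simp
  have "exp (- r) / CARD('m) = exp (- (r / 2)) / (CARD('m) * exp (r / 2))"
    by (simp add: field_simps flip: exp_add)
  also have "\<dots> \<le> exp (a k) / (CARD('m) * exp (r / 2))"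
    using assms[of k] by (intro divide_right_mono) auto
  also have "\<dots> \<le> softmax a k"
    unfolding softmax_def using * by (intro divide_left_mono mult_pos_pos sum_exp_pos) auto
  finally show ?thesis .
qed

section \<open>Weighted mean and variance\<close>

definition wmean :: "('m::finite \<Rightarrow> real) \<Rightarrow> ('m \<Rightarrow> 'a::real_inner) \<Rightarrow> 'a" where
  "wmean p z = (\<Sum>k\<in>UNIV. p k *\<^sub>R z k)"

definition wvar :: "('m::finite \<Rightarrow> real) \<Rightarrow> ('m \<Rightarrow> 'a::real_inner) \<Rightarrow> real" where
  "wvar p z = (\<Sum>k\<in>UNIV. p k * (norm (z k - wmean p z))\<^sup>2)"

lemma inner_wmean_right: "u \<bullet> wmean p z = (\<Sum>k\<in>UNIV. p k * (u \<bullet> z k))"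
  by (simp add: wmean_def inner_sum_right)

lemma wmean_centered:
  assumes "sum p UNIV = 1"
  shows "(\<Sum>k\<in>UNIV. p k * (u \<bullet> (z k - wmean p z))) = 0"
proof -
  have "(\<Sum>k\<in>UNIV. p k * (u \<bullet> (z k - wmean p z))) = u \<bullet> wmean p z - sum p UNIV * (u \<bullet> wmean p z)"
    by (simp add: inner_diff_right right_diff_distrib sum_subtractf inner_wmean_right
        sum_distrib_right)
  thus ?thesis using assms by simp
qed

text \<open>The parallel axis identity: expanding the square around the weighted mean leaves a cross
  term that vanishes by centring. With \<open>c = 0\<close> it computes the second moment, and it
  shows that the mean minimises the weighted squared distance.\<close>

lemma sum_sq_dist_eq_wvar:
  assumes "sum p UNIV = 1"
  shows "(\<Sum>k\<in>UNIV. p k * (norm (z k - c))\<^sup>2) = wvar p z + (norm (wmean p z - c))\<^sup>2"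
proof -
  let ?m = "wmean p z"
  have "(norm (z k - c))\<^sup>2 = (norm (z k - ?m))\<^sup>2 + 2 * ((?m - c) \<bullet> (z k - ?m)) + (norm (?m - c))\<^sup>2" for k
    by (simp add: power2_norm_eq_inner inner_diff_left inner_diff_right inner_commute)
  hence "(\<Sum>k\<in>UNIV. p k * (norm (z k - c))\<^sup>2) =
     wvar p z + 2 * (\<Sum>k\<in>UNIV. p k * ((?m - c) \<bullet> (z k - ?m))) + sum p UNIV * (norm (?m - c))\<^sup>2"
    by (simp add: wvar_def distrib_left sum.distrib sum_distrib_left sum_distrib_right mult.left_commute)
  thus ?thesis using wmean_centered[OF assms, of "?m - c" z] assms by simp
qed

lemma wvar_nonneg: "(\<And>k. 0 \<le> p k) \<Longrightarrow> 0 \<le> wvar p z"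
  unfolding wvar_def by (intro sum_nonneg mult_nonneg_nonneg) auto

lemma wvar_le_sum:
  assumes "sum p UNIV = 1"
  shows "wvar p z \<le> (\<Sum>k\<in>UNIV. p k * (norm (z k - c))\<^sup>2)"
  by (simp add: sum_sq_dist_eq_wvar[OF assms])

text \<open>The two variances have different centres. Since the mean of \<open>p\<close> is the
  optimal centre for \<open>p\<close>, moving to the mean of \<open>q\<close> only increases the
  sum, and then the weights compare termwise.\<close>

lemma wvar_mono:
  assumes "sum p UNIV = 1" "\<And>k. p k \<le> r * q k"
  shows "wvar p z \<le> r * wvar q z"
proof -
  have "wvar p z \<le> (\<Sum>k\<in>UNIV. p k * (norm (z k - wmean q z))\<^sup>2)"
    by (rule wvar_le_sum[OF assms(1)])
  also have "\<dots> \<le> (\<Sum>k\<in>UNIV. r * q k * (norm (z k - wmean q z))\<^sup>2)"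
    by (intro sum_mono mult_right_mono assms) auto
  finally show ?thesis by (simp add: wvar_def sum_distrib_left mult.assoc)
qed

text \<open>Spread-out tokens in the unit ball have a short mean: variance plus squared norm of the
  mean is at most 1, and 2b \<le> 1 + b^2 makes this linear in the norm b.\<close>

lemma norm_wmean_le:
  assumes p: "\<And>k. 0 \<le> p k" "sum p UNIV = 1" and z: "\<And>k. norm (z k) \<le> 1"
  shows "norm (wmean p z) \<le> 1 - wvar p z / 2"
proof -
  let ?b = "norm (wmean p z)"
  have "wvar p z + ?b\<^sup>2 = (\<Sum>k\<in>UNIV. p k * (norm (z k))\<^sup>2)"
    using sum_sq_dist_eq_wvar[OF p(2), of z 0] by simp
  also have "\<dots> \<le> (\<Sum>k\<in>UNIV. p k * 1)"
    by (intro sum_mono mult_left_mono p) (use z in \<open>simp add: abs_square_le_1\<close>)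
  finally have "wvar p z + ?b\<^sup>2 \<le> 1" using p by simp
  moreover have "2 * ?b \<le> 1 + ?b\<^sup>2"
    using zero_le_power2[of "?b - 1"] by (simp add: power2_diff)
  ultimately show ?thesis by simp
qed

section \<open>The attention map\<close>

lemma norm_mat_vec_le: "norm (A *v x) \<le> mat_norm A * norm x"
  unfolding mat_norm_def by (rule onorm) (rule matrix_vector_mul_bounded_linear)

lemma abs_score_le:
  assumes "mat_norm W \<le> r"
  shows "\<bar>x \<bullet> (W *v y)\<bar> \<le> r * norm x * norm y"
proof -
  have "\<bar>x \<bullet> (W *v y)\<bar> \<le> norm x * norm (W *v y)" by (rule Cauchy_Schwarz_ineq2)
  also have "\<dots> \<le> norm x * (r * norm y)"
    using norm_mat_vec_le[of W y] mult_right_mono[OF assms, of "norm y"]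
    by (intro mult_left_mono) auto
  finally show ?thesis by (simp add: ac_simps)
qed

abbreviation score :: "real^'d^'d \<Rightarrow> (real^'d)^'m \<Rightarrow> 'm \<Rightarrow> 'm \<Rightarrow> real" where
  "score W S j \<equiv> (\<lambda>k. S$j \<bullet> (W *v S$k))"

definition attn_mean :: "real^'d^'d \<Rightarrow> (real^'d)^'m \<Rightarrow> 'm \<Rightarrow> real^'d" where
  "attn_mean W S j = wmean (softmax (score W S j)) (\<lambda>k. S$k)"

text \<open>Pulling \<open>V\<close> out of the average isolates the nonlinear part
  \<open>attn_mean\<close>; \<open>V\<close> can then be treated together with the MLP as a
  contraction.\<close>

lemma attn_nth: "attn W V S $ j = V *v attn_mean W S j"
proof -
  have "V *v attn_mean W S j = (\<Sum>k\<in>UNIV. V *v (softmax (score W S j) k *\<^sub>R S$k))"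
    unfolding attn_mean_def wmean_def by (rule linear_sum) simp
  also have "\<dots> = (\<Sum>k\<in>UNIV. softmax (score W S j) k *\<^sub>R (V *v S$k))"
    by (intro sum.cong refl linear_scale) simp
  finally show ?thesis by (simp add: attn_def softmax_def)
qed

section \<open>Directional derivative of the attention mean\<close>

definition attn_mean_deriv :: "real^'d^'d \<Rightarrow> (real^'d)^'m \<Rightarrow> (real^'d)^'m \<Rightarrow> real^'d \<Rightarrow> 'm \<Rightarrow> real" where
  "attn_mean_deriv W S D u j = (\<Sum>k\<in>UNIV. softmax (score W S j) k *
     (u \<bullet> D$k + (D$j \<bullet> (W *v S$k) + S$j \<bullet> (W *v D$k)) * (u \<bullet> (S$k - attn_mean W S j))))"

lemma score_has_derivative:
  fixes S D :: "(real^'d)^'m"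
  shows "((\<lambda>t. score W (S + t *\<^sub>R D) j k) has_real_derivative
      D$j \<bullet> (W *v (S + t *\<^sub>R D)$k) + (S + t *\<^sub>R D)$j \<bullet> (W *v D$k)) (at t)"
proof -
  \<comment> \<open>By bilinearity the score is a quadratic polynomial in \<open>t\<close>.\<close>
  have eq: "score W (S + t *\<^sub>R D) j k = S$j \<bullet> (W *v S$k)
      + t * (D$j \<bullet> (W *v S$k) + S$j \<bullet> (W *v D$k)) + t\<^sup>2 * (D$j \<bullet> (W *v D$k))" for t
    by (simp add: matrix_vector_right_distrib matrix_vector_mult_scaleR inner_add_left inner_add_right
        power2_eq_square algebra_simps)
  show ?thesis unfolding eq
    by (auto intro!: derivative_eq_intros
        simp: matrix_vector_right_distrib matrix_vector_mult_scaleR inner_add_left inner_add_right algebra_simps)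
qed

text \<open>The quotient rule for \<open>N t / Z t\<close>, rewritten as a covariance: the
  subtracted term, the mean times the derivative of \<open>Z\<close>, is spread over the sum and
  centres each value at the mean.\<close>

lemma attn_mean_has_derivative:
  fixes S D :: "(real^'d)^'m"
  shows "((\<lambda>t. u \<bullet> attn_mean W (S + t *\<^sub>R D) j) has_real_derivative
      attn_mean_deriv W (S + t *\<^sub>R D) D u j) (at t)"
proof -
  define T where "T t = S + t *\<^sub>R D" for t
  define a where "a t k = score W (T t) j k" for t k
  define a' where "a' k = D$j \<bullet> (W *v T t$k) + T t$j \<bullet> (W *v D$k)" for k
  define Z where "Z t = (\<Sum>k\<in>UNIV. exp (a t k))" for t
  define N where "N t = (\<Sum>k\<in>UNIV. exp (a t k) * (u \<bullet> T t$k))" for t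
  have Zpos: "Z t > 0" for t unfolding Z_def by (rule sum_exp_pos)
  have mean: "u \<bullet> attn_mean W (T t) j = N t / Z t" for t
    by (simp add: attn_mean_def inner_wmean_right softmax_def N_def Z_def a_def sum_divide_distrib)
  have da: "((\<lambda>t. a t k) has_real_derivative a' k) (at t)" for k
    unfolding a_def a'_def T_def by (rule score_has_derivative)
  have dT: "((\<lambda>t. u \<bullet> T t$k) has_real_derivative u \<bullet> D$k) (at t)" for k
    unfolding T_def by (auto intro!: derivative_eq_intros simp: inner_add_right)
  have dZ: "(Z has_real_derivative (\<Sum>k\<in>UNIV. exp (a t k) * a' k)) (at t)"
    unfolding Z_def by (auto intro!: derivative_eq_intros da)
  have dN: "(N has_real_derivative
      (\<Sum>k\<in>UNIV. exp (a t k) * a' k * (u \<bullet> T t$k) + exp (a t k) * (u \<bullet> D$k))) (at t)"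
    unfolding N_def by (auto intro!: derivative_eq_intros da dT simp: algebra_simps)
  have "((\<lambda>t. N t / Z t) has_real_derivative
      ((\<Sum>k\<in>UNIV. exp (a t k) * a' k * (u \<bullet> T t$k) + exp (a t k) * (u \<bullet> D$k)) * Z t
        - N t * (\<Sum>k\<in>UNIV. exp (a t k) * a' k)) / (Z t * Z t)) (at t)"
    by (rule DERIV_divide[OF dN dZ]) (use Zpos[of t] in simp)
  also have "((\<Sum>k\<in>UNIV. exp (a t k) * a' k * (u \<bullet> T t$k) + exp (a t k) * (u \<bullet> D$k)) * Z t
        - N t * (\<Sum>k\<in>UNIV. exp (a t k) * a' k)) / (Z t * Z t) =
      (\<Sum>k\<in>UNIV. exp (a t k) * a' k * (u \<bullet> T t$k) + exp (a t k) * (u \<bullet> D$k)) / Z t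
        - (N t / Z t) * (\<Sum>k\<in>UNIV. exp (a t k) * a' k) / Z t"
    using Zpos[of t] by (simp add: field_simps)
  also have "\<dots> = (\<Sum>k\<in>UNIV. exp (a t k) / Z t * (u \<bullet> D$k + a' k * (u \<bullet> T t$k - N t / Z t)))"
    by (simp add: sum_divide_distrib sum_distrib_left sum_subtractf[symmetric] algebra_simps add_divide_distrib diff_divide_distrib)
  also have "\<dots> = attn_mean_deriv W (T t) D u j"
    by (simp add: attn_mean_deriv_def inner_diff_right mean a'_def softmax_def a_def Z_def)
  finally show ?thesis using mean by (simp add: T_def)
qed

text \<open>A perturbed token acts in two roles: as value and key (\<open>D$k\<close>) it counts
  with its own softmax weight, as query (\<open>D$j\<close>) it shifts all scores of row
  \<open>j\<close>. The vector \<open>u\<close> tests the velocity in a single direction.\<close>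

lemma abs_attn_mean_deriv_le:
  fixes S D :: "(real^'d)^'m" and j :: 'm
  assumes S: "valid_input S" and W: "mat_norm W \<le> \<Gamma> / 2" and u: "norm u \<le> 1" and "\<Gamma> \<ge> 0"
  defines "p \<equiv> softmax (score W S j)"
  shows "\<bar>attn_mean_deriv W S D u j\<bar> \<le>
     (\<Sum>k\<in>UNIV. p k * (norm (D$k) * (1 + \<Gamma> / 2 * norm (S$k - attn_mean W S j))))
     + \<Gamma> / 2 * norm (D$j) * wvar p (\<lambda>k. S$k)"
proof -
  define m where "m = attn_mean W S j"
  have m: "m = wmean p (\<lambda>k. S$k)" by (simp add: m_def p_def attn_mean_def)
  have pos: "0 \<le> p k" for k unfolding p_def by (rule softmax_nonneg)
  have sum1: "sum p UNIV = 1" unfolding p_def by (rule sum_softmax)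
  have ub: "\<bar>u \<bullet> x\<bar> \<le> norm x" for x
    using Cauchy_Schwarz_ineq2[of u x] mult_right_mono[OF u, of "norm x"] by simp
  \<comment> \<open>The tokens inside the score may be centred as well, since \<open>S$k - m\<close> has mean zero;
     this turns the contribution of \<open>D$j\<close> into a variance.\<close>
  have "(\<Sum>k\<in>UNIV. p k * ((D$j \<bullet> (W *v m)) * (u \<bullet> (S$k - m)))) = 0"
    using wmean_centered[OF sum1, of u "\<lambda>k. S$k"]
    by (subst mult.left_commute) (simp add: m flip: sum_distrib_left)
  hence eq: "attn_mean_deriv W S D u j =
      (\<Sum>k\<in>UNIV. p k * (u \<bullet> D$k + (S$j \<bullet> (W *v D$k)) * (u \<bullet> (S$k - m))))
    + (\<Sum>k\<in>UNIV. p k * ((D$j \<bullet> (W *v (S$k - m))) * (u \<bullet> (S$k - m))))"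
    by (simp add: attn_mean_deriv_def p_def[symmetric] m_def[symmetric] matrix_vector_mult_diff_distrib
        inner_diff_right[of "D$j"] left_diff_distrib right_diff_distrib distrib_left distrib_right
        sum.distrib sum_subtractf)
  have "\<bar>attn_mean_deriv W S D u j\<bar> \<le> (\<Sum>k\<in>UNIV. p k * (norm (D$k) * (1 + \<Gamma> / 2 * norm (S$k - m))))
    + (\<Sum>k\<in>UNIV. p k * (\<Gamma> / 2 * norm (D$j) * (norm (S$k - m))\<^sup>2))"
  unfolding eq
  proof (rule order_trans[OF abs_triangle_ineq], rule add_mono;
      rule order_trans[OF sum_abs], rule sum_mono)
    fix k
    have "\<bar>S$j \<bullet> (W *v D$k)\<bar> \<le> \<Gamma> / 2 * norm (S$j) * norm (D$k)" by (rule abs_score_le[OF W])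
    also have "\<dots> \<le> \<Gamma> / 2 * 1 * norm (D$k)"
      using S \<open>\<Gamma> \<ge> 0\<close> unfolding valid_input_def by (intro mult_mono) auto
    finally have "\<bar>(S$j \<bullet> (W *v D$k)) * (u \<bullet> (S$k - m))\<bar> \<le> \<Gamma> / 2 * norm (D$k) * norm (S$k - m)"
      unfolding abs_mult using \<open>\<Gamma> \<ge> 0\<close> by (intro mult_mono ub) auto
    hence "\<bar>u \<bullet> D$k + (S$j \<bullet> (W *v D$k)) * (u \<bullet> (S$k - m))\<bar>
        \<le> norm (D$k) * (1 + \<Gamma> / 2 * norm (S$k - m))"
      using ub[of "D$k"] abs_triangle_ineq[of "u \<bullet> D$k" "(S$j \<bullet> (W *v D$k)) * (u \<bullet> (S$k - m))"]
      by (simp add: distrib_left mult_ac)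
    thus "\<bar>p k * (u \<bullet> D$k + (S$j \<bullet> (W *v D$k)) * (u \<bullet> (S$k - m)))\<bar>
        \<le> p k * (norm (D$k) * (1 + \<Gamma> / 2 * norm (S$k - m)))"
      using pos[of k] by (simp add: abs_mult mult_left_mono)
    have "\<bar>(D$j \<bullet> (W *v (S$k - m))) * (u \<bullet> (S$k - m))\<bar>
        \<le> (\<Gamma> / 2 * norm (D$j) * norm (S$k - m)) * norm (S$k - m)"
      unfolding abs_mult using \<open>\<Gamma> \<ge> 0\<close> by (intro mult_mono ub abs_score_le[OF W]) auto
    thus "\<bar>p k * ((D$j \<bullet> (W *v (S$k - m))) * (u \<bullet> (S$k - m)))\<bar>
        \<le> p k * (\<Gamma> / 2 * norm (D$j) * (norm (S$k - m))\<^sup>2)"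
      using pos[of k] by (simp add: abs_mult mult_left_mono power2_eq_square mult.assoc)
  qed
  moreover have "(\<Sum>k\<in>UNIV. p k * (\<Gamma> / 2 * norm (D$j) * (norm (S$k - m))\<^sup>2))
      = \<Gamma> / 2 * norm (D$j) * wvar p (\<lambda>k. S$k)"
    by (simp add: wvar_def m sum_distrib_left mult_ac)
  ultimately show ?thesis by (simp only: m_def)
qed

section \<open>The Lipschitz constant of attention\<close>

lemma lipschitz_constant_le:
  fixes \<Gamma> V :: real
  assumes "\<Gamma> \<ge> 0" "V \<ge> 0"
  shows "exp (\<Gamma> - \<Gamma> * V / 4) * (1 + \<Gamma> / 2 * (2 - exp (- \<Gamma>) * V / 2) + \<Gamma> / 2 * V)
     \<le> (1 + \<Gamma>) * exp \<Gamma>"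
proof -
  \<comment> \<open>With \<open>exp (- \<Gamma>)\<close> replaced by its tangent 1 - \<Gamma>, the
    bracket factors exactly as (1 + \<Gamma>)(1 + \<Gamma> V / 4). The second factor is at most
    \<open>exp (\<Gamma> * V / 4)\<close>, which cancels the saving in the exponent.\<close>
  have "\<Gamma> * V * (1 - \<Gamma>) \<le> \<Gamma> * V * exp (- \<Gamma>)"
    using assms exp_ge_add_one_self[of "- \<Gamma>"] by (intro mult_left_mono) auto
  hence "1 + \<Gamma> / 2 * (2 - exp (- \<Gamma>) * V / 2) + \<Gamma> / 2 * V \<le> (1 + \<Gamma>) * (1 + \<Gamma> * V / 4)"
    by (simp add: field_simps)
  also have "\<dots> \<le> (1 + \<Gamma>) * exp (\<Gamma> * V / 4)"
    using assms by (intro mult_left_mono exp_ge_add_one_self) auto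
  finally have "exp (\<Gamma> - \<Gamma> * V / 4) * (1 + \<Gamma> / 2 * (2 - exp (- \<Gamma>) * V / 2) + \<Gamma> / 2 * V)
      \<le> exp (\<Gamma> - \<Gamma> * V / 4) * ((1 + \<Gamma>) * exp (\<Gamma> * V / 4))"
    by (intro mult_left_mono) auto
  also have "\<dots> = (1 + \<Gamma>) * exp \<Gamma>" by (simp add: exp_diff)
  finally show ?thesis .
qed

lemma sum_abs_attn_mean_deriv_le:
  fixes S D :: "(real^'d)^'m"
  assumes S: "valid_input S" and W: "mat_norm W \<le> \<Gamma> / 2" and u: "\<And>j. norm (u j) \<le> 1" and "\<Gamma> \<ge> 0"
  shows "(\<Sum>j\<in>UNIV. \<bar>attn_mean_deriv W S D (u j) j\<bar>) \<le> (1 + \<Gamma>) * exp \<Gamma> * norm_2_1 D"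
proof -
  define p where "p j = softmax (score W S j)" for j
  define q where "q = (\<lambda>k::'m. 1 / real CARD('m))"
  define z where "z = (\<lambda>k. S$k)"
  define V where "V = wvar q z"
  define E where "E = exp (\<Gamma> - \<Gamma> * V / 4)"
  define X where "X = 2 - exp (- \<Gamma>) * V / 2"
  have z: "norm (z k) \<le> 1" for k using S by (simp add: valid_input_def z_def)
  have p: "0 \<le> p j k" "sum (p j) UNIV = 1" for j k
    unfolding p_def by (simp_all add: softmax_nonneg sum_softmax)
  have q: "0 \<le> q k" "sum q UNIV = 1" for k unfolding q_def by simp_all
  have V0: "V \<ge> 0" unfolding V_def by (rule wvar_nonneg) (rule q)
  have p_le: "p j k \<le> E * q k" for j k
  proof -
    \<comment> \<open>The row average of the scores is the score against the uniform mean, so the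
      excess in \<open>softmax_le\<close> is a score against a centred token.\<close>
    have "(\<Sum>l\<in>UNIV. score W S j l) / CARD('m) = z j \<bullet> (W *v wmean q z)"
    proof -
      have "W *v wmean q z = (\<Sum>l\<in>UNIV. W *v (q l *\<^sub>R z l))"
        unfolding wmean_def by (rule linear_sum) simp
      thus ?thesis
        by (simp add: inner_sum_right q_def z_def matrix_vector_mult_scaleR sum_divide_distrib)
    qed
    hence "score W S j k - (\<Sum>l\<in>UNIV. score W S j l) / CARD('m) = z j \<bullet> (W *v (z k - wmean q z))"
      by (simp add: z_def matrix_vector_mult_diff_distrib inner_diff_right)
    also have "\<dots> \<le> \<Gamma> / 2 * norm (z j) * norm (z k - wmean q z)"
      using abs_score_le[OF W] abs_le_D1 by blast
    \<comment> \<open>A token has norm at most 1 and the uniform mean at most 1 - V / 2; the product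
      is the exponent of \<open>E\<close>.\<close>
    also have "\<dots> \<le> \<Gamma> / 2 * 1 * (2 - V / 2)"
    proof (intro mult_mono)
      show "norm (z k - wmean q z) \<le> 2 - V / 2"
        using norm_triangle_ineq4[of "z k" "wmean q z"] z[of k] norm_wmean_le[of q z, OF q z]
        by (simp add: V_def)
    qed (use z \<open>\<Gamma> \<ge> 0\<close> in auto)
    finally have "exp (score W S j k - (\<Sum>l\<in>UNIV. score W S j l) / CARD('m)) \<le> E"
      by (simp add: E_def algebra_simps)
    from order_trans[OF softmax_le divide_right_mono[OF this]]
    show ?thesis by (simp add: p_def q_def)
  qed
  have var_le: "wvar (p j) z \<le> E * V" for j
    unfolding V_def by (intro wvar_mono p p_le)
  have dist_le: "norm (z k - wmean (p j) z) \<le> X" for j k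
  proof -
    have "\<bar>score W S j l\<bar> \<le> \<Gamma> / 2" for l
    proof -
      have "\<bar>score W S j l\<bar> \<le> \<Gamma> / 2 * norm (z j) * norm (z l)"
        unfolding z_def by (rule abs_score_le[OF W])
      also have "\<dots> \<le> \<Gamma> / 2 * 1 * 1" using z \<open>\<Gamma> \<ge> 0\<close> by (intro mult_mono) auto
      finally show ?thesis by simp
    qed
    \<comment> \<open>The comparison now runs the other way: uniform weights are dominated by
      softmax weights, so every row has variance at least \<open>exp (- \<Gamma>) * V\<close>, which
      shortens its mean.\<close>
    from softmax_ge[OF this] have "q l \<le> exp \<Gamma> * p j l" for l
      by (simp add: p_def q_def exp_minus field_simps)
    hence "V \<le> exp \<Gamma> * wvar (p j) z"
      unfolding V_def by (intro wvar_mono q)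
    hence "exp (- \<Gamma>) * V \<le> wvar (p j) z"
      by (simp add: exp_minus field_simps)
    thus ?thesis
      using norm_triangle_ineq4[of "z k" "wmean (p j) z"] z[of k] norm_wmean_le[of "p j" z, OF p z]
      by (simp add: X_def)
  qed
  have X0: "X \<ge> 0" using order_trans[OF norm_ge_zero dist_le] .
  have "(\<Sum>j\<in>UNIV. \<bar>attn_mean_deriv W S D (u j) j\<bar>)
      \<le> (\<Sum>j\<in>UNIV. (\<Sum>k\<in>UNIV. E * q k * (norm (D$k) * (1 + \<Gamma> / 2 * X))) + \<Gamma> / 2 * norm (D$j) * (E * V))"
  proof (intro sum_mono)
    fix j
    have "\<bar>attn_mean_deriv W S D (u j) j\<bar> \<le>
      (\<Sum>k\<in>UNIV. p j k * (norm (D$k) * (1 + \<Gamma> / 2 * norm (z k - wmean (p j) z))))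
      + \<Gamma> / 2 * norm (D$j) * wvar (p j) z"
      using abs_attn_mean_deriv_le[OF S W u \<open>\<Gamma> \<ge> 0\<close>, of D j j]
      by (simp add: p_def z_def attn_mean_def)
    also have "\<dots> \<le> (\<Sum>k\<in>UNIV. E * q k * (norm (D$k) * (1 + \<Gamma> / 2 * X))) + \<Gamma> / 2 * norm (D$j) * (E * V)"
      using \<open>\<Gamma> \<ge> 0\<close> q(1)
      by (intro add_mono sum_mono mult_mono p_le var_le dist_le order_refl mult_nonneg_nonneg
          add_nonneg_nonneg wvar_nonneg p) (auto simp: E_def)
    finally show "\<bar>attn_mean_deriv W S D (u j) j\<bar> \<le>
      (\<Sum>k\<in>UNIV. E * q k * (norm (D$k) * (1 + \<Gamma> / 2 * X))) + \<Gamma> / 2 * norm (D$j) * (E * V)" .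
  qed
  also have "\<dots> = E * (1 + \<Gamma> / 2 * X + \<Gamma> / 2 * V) * norm_2_1 D"
  proof -
    \<comment> \<open>The inner sum does not depend on \<open>j\<close>; its factor 1 /
      \<open>CARD('m)\<close> cancels against the number of rows.\<close>
    have "(\<Sum>k\<in>UNIV. E * q k * (norm (D$k) * (1 + \<Gamma> / 2 * X)))
        = E * (1 + \<Gamma> / 2 * X) * norm_2_1 D / CARD('m)"
      unfolding norm_2_1_def sum_distrib_left sum_divide_distrib
      by (intro sum.cong refl) (simp add: q_def mult_ac)
    moreover have "(\<Sum>j\<in>UNIV. \<Gamma> / 2 * norm (D$j) * (E * V)) = \<Gamma> / 2 * norm_2_1 D * (E * V)"
      by (simp add: norm_2_1_def sum_distrib_left sum_distrib_right mult_ac)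
    ultimately show ?thesis
      by (simp only: sum.distrib sum_constant) (simp add: field_simps)
  qed
  also have "\<dots> \<le> (1 + \<Gamma>) * exp \<Gamma> * norm_2_1 D"
    unfolding E_def X_def
    by (intro mult_right_mono lipschitz_constant_le \<open>\<Gamma> \<ge> 0\<close> V0) (simp add: norm_2_1_def sum_nonneg)
  finally show ?thesis .
qed

lemma valid_input_segment:
  assumes "valid_input S" "valid_input S'" "0 \<le> t" "t \<le> 1"
  shows "valid_input (S + t *\<^sub>R (S' - S))"
  unfolding valid_input_def
proof
  fix j
  have "(S + t *\<^sub>R (S' - S)) $ j = (1 - t) *\<^sub>R S$j + t *\<^sub>R S'$j"
    by (simp add: algebra_simps)
  also have "norm \<dots> \<le> (1 - t) * norm (S$j) + t * norm (S'$j)"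
    by (rule norm_triangle_le) (use assms in simp)
  also have "\<dots> \<le> 1"
    by (rule convex_bound_le) (use assms in \<open>auto simp: valid_input_def\<close>)
  finally show "norm ((S + t *\<^sub>R (S' - S)) $ j) \<le> 1" .
qed

lemma attn_mean_lipschitz:
  fixes S S' :: "(real^'d)^'m"
  assumes S: "valid_input S" "valid_input S'" and W: "mat_norm W \<le> \<Gamma> / 2" and "\<Gamma> \<ge> 0"
  shows "(\<Sum>j\<in>UNIV. norm (attn_mean W S' j - attn_mean W S j)) \<le> (1 + \<Gamma>) * exp \<Gamma> * norm_2_1 (S' - S)"
proof -
  define T where "T t = S + t *\<^sub>R (S' - S)" for t
  \<comment> \<open>Testing each row against the direction of its own difference turns the sum of
    norms into one scalar increment. A single mean value theorem then yields one \<open>t\<close>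
    for all rows, as the summed derivative bound requires. Rows without difference get
    \<open>sgn 0 = 0\<close>.\<close>
  define u where "u j = sgn (attn_mean W S' j - attn_mean W S j)" for j
  define g where "g t = (\<Sum>j\<in>UNIV. u j \<bullet> attn_mean W (T t) j)" for t
  define g' where "g' t = (\<Sum>j\<in>UNIV. attn_mean_deriv W (T t) (S' - S) (u j) j)" for t
  have dg: "(g has_real_derivative g' t) (at t)" for t
    unfolding g_def g'_def T_def by (intro DERIV_sum attn_mean_has_derivative)
  obtain t where t: "0 < t" "t < 1" "g 1 - g 0 = (1 - 0) * g' t"
    using MVT2[of 0 1 g g'] dg by auto
  have u: "norm (u j) \<le> 1" for j by (simp add: u_def norm_sgn)
  have u_inner: "sgn x \<bullet> x = norm x" for x :: "real^'d"
    by (cases "x = 0") (simp_all add: sgn_div_norm power2_norm_eq_inner[symmetric] power2_eq_square)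
  have "(\<Sum>j\<in>UNIV. norm (attn_mean W S' j - attn_mean W S j)) = g 1 - g 0"
    by (simp add: g_def T_def u_def u_inner flip: sum_subtractf inner_diff_right)
  also have "\<dots> \<le> (\<Sum>j\<in>UNIV. \<bar>attn_mean_deriv W (T t) (S' - S) (u j) j\<bar>)"
    using t by (simp add: g'_def sum_mono)
  also have "\<dots> \<le> (1 + \<Gamma>) * exp \<Gamma> * norm_2_1 (S' - S)"
    by (intro sum_abs_attn_mean_deriv_le W u \<open>\<Gamma> \<ge> 0\<close>)
      (use valid_input_segment[OF S] t in \<open>simp add: T_def\<close>)
  finally show ?thesis .
qed

section \<open>The transformer\<close>

lemma norm_act_diff_le: "norm (act \<phi> x - act \<phi> y) \<le> norm (x - y)"
proof (cases \<phi>)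
  case ReLU
  thus ?thesis by (auto simp: act_def intro!: norm_le_componentwise_cart)
qed (simp add: act_def)

lemma act_0 [simp]: "act \<phi> 0 = 0"
  by (cases \<phi>) (simp_all add: act_def vec_eq_iff)

lemma norm_mat_vec_contract: "mat_norm A \<le> 1 \<Longrightarrow> norm (A *v x) \<le> norm x"
  using norm_mat_vec_le[of A x] mult_right_mono[of "mat_norm A" 1 "norm x"] by simp

lemma norm_layer_diff_le:
  assumes "mat_norm M \<le> 1" "mat_norm V \<le> 1"
  shows "norm (act \<phi> (M *v (V *v x)) - act \<phi> (M *v (V *v y))) \<le> norm (x - y)"
proof -
  have "norm (act \<phi> (M *v (V *v x)) - act \<phi> (M *v (V *v y))) \<le> norm (M *v (V *v (x - y)))"
    using norm_act_diff_le by (simp add: matrix_vector_mult_diff_distrib)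
  also have "\<dots> \<le> norm (x - y)"
    by (intro order_trans[OF norm_mat_vec_contract] norm_mat_vec_contract assms)
  finally show ?thesis .
qed

lemma norm_attn_mean_le:
  assumes "valid_input S"
  shows "norm (attn_mean W S j) \<le> 1"
  using norm_wmean_le[of "softmax (score W S j)" "\<lambda>k. S$k"]
    wvar_nonneg[of "softmax (score W S j)" "\<lambda>k. S$k"] assms
  by (simp add: attn_mean_def softmax_nonneg sum_softmax valid_input_def)

text \<open>The Lipschitz bound for attention holds only for tokens in the unit ball; invariance of
  the ball allows it to be applied at every layer.\<close>

lemma valid_input_layers:
  assumes "admissible \<Gamma> c L H W V M" "valid_input S" "i \<le> L"
  shows "valid_input (layers \<phi> W V M i S)"
  using assms(3)
proof (induction i)
  case 0
  thus ?case using assms by simp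
next
  case (Suc i)
  hence v: "valid_input (layers \<phi> W V M i S)" by simp
  have adm: "mat_norm (V (Suc i)) \<le> 1" "mat_norm (M (Suc i) j) \<le> 1" for j
    using assms(1) Suc.prems by (auto simp: admissible_def)
  show ?case unfolding valid_input_def
  proof
    fix j
    show "norm (layers \<phi> W V M (Suc i) S $ j) \<le> 1"
      \<comment> \<open>Comparison with the zero vector turns the contraction into a norm bound,
        because \<open>act\<close> fixes 0.\<close>
      using norm_layer_diff_le[OF adm(2)[of j] adm(1), of \<phi>
          "attn_mean (W (Suc i)) (layers \<phi> W V M i S) j" 0] norm_attn_mean_le[OF v, of "W (Suc i)" j]
      by (simp add: parallel_mlp_def attn_nth)
  qed
qed

lemma layers_lipschitz:
  assumes "admissible \<Gamma> c L H W V M" "valid_input S" "valid_input S'" "\<Gamma> \<ge> 0" "i \<le> L"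
  shows "norm_2_1 (layers \<phi> W V M i S - layers \<phi> W V M i S')
     \<le> ((1 + \<Gamma>) * exp \<Gamma>) ^ i * norm_2_1 (S - S')"
  using assms(5)
proof (induction i)
  case 0
  thus ?case by simp
next
  case (Suc i)
  let ?X = "layers \<phi> W V M i S" and ?Y = "layers \<phi> W V M i S'"
  have adm: "mat_norm (V (Suc i)) \<le> 1" "mat_norm (W (Suc i)) \<le> \<Gamma> / 2" "mat_norm (M (Suc i) j) \<le> 1" for j
    using assms(1) Suc.prems by (auto simp: admissible_def)
  have "norm_2_1 (layers \<phi> W V M (Suc i) S - layers \<phi> W V M (Suc i) S')
      \<le> (\<Sum>j\<in>UNIV. norm (attn_mean (W (Suc i)) ?X j - attn_mean (W (Suc i)) ?Y j))"
    unfolding norm_2_1_def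
    by (intro sum_mono) (simp add: parallel_mlp_def attn_nth norm_layer_diff_le adm)
  also have "\<dots> \<le> (1 + \<Gamma>) * exp \<Gamma> * norm_2_1 (?X - ?Y)"
    using Suc.prems assms by (intro attn_mean_lipschitz adm valid_input_layers) auto
  also have "\<dots> \<le> (1 + \<Gamma>) * exp \<Gamma> * (((1 + \<Gamma>) * exp \<Gamma>) ^ i * norm_2_1 (S - S'))"
    using Suc \<open>\<Gamma> \<ge> 0\<close> by (intro mult_left_mono) auto
  finally show ?case by (simp add: mult_ac)
qed

text \<open>The (2,\<infinity>) bound on \<open>H\<close> is dual to the (2,1) norm of the
  difference of the final layers.\<close>

lemma TF_lipschitz:
  fixes H S S' :: "(real^'d)^'m"
  assumes adm: "admissible \<Gamma> c L H W V M" and S: "valid_input S" "valid_input S'" and "\<Gamma> \<ge> 0" "c \<ge> 0"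
  shows "\<bar>TF \<phi> L H W V M S - TF \<phi> L H W V M S'\<bar>
     \<le> c / real CARD('m) * ((1 + \<Gamma>) * exp \<Gamma>) ^ L * norm_2_1 (S - S')"
proof -
  let ?D = "layers \<phi> W V M L S - layers \<phi> W V M L S'"
  have H: "norm (H$j) \<le> c / CARD('m)" for j
  proof -
    have "norm (H$j) \<le> norm_2_inf H" unfolding norm_2_inf_def by (intro Max_ge) auto
    thus ?thesis using adm by (simp add: admissible_def)
  qed
  have "\<bar>TF \<phi> L H W V M S - TF \<phi> L H W V M S'\<bar> = \<bar>\<Sum>j\<in>UNIV. H$j \<bullet> ?D$j\<bar>"
    by (simp add: TF_def inner_diff_right sum_subtractf)
  also have "\<dots> \<le> (\<Sum>j\<in>UNIV. c / CARD('m) * norm (?D$j))"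
    by (intro order_trans[OF sum_abs] sum_mono order_trans[OF Cauchy_Schwarz_ineq2] mult_right_mono H) auto
  also have "\<dots> = c / CARD('m) * norm_2_1 ?D"
    by (simp add: norm_2_1_def sum_distrib_left)
  also have "\<dots> \<le> c / CARD('m) * (((1 + \<Gamma>) * exp \<Gamma>) ^ L * norm_2_1 (S - S'))"
    using \<open>c \<ge> 0\<close> by (intro mult_left_mono layers_lipschitz[OF adm S \<open>\<Gamma> \<ge> 0\<close>]) auto
  finally show ?thesis by (simp add: mult_ac)
qed

text \<open>Identical tokens are a fixed point of attention, since softmax weights sum to one.\<close>

lemma layers_const:
  assumes "act \<phi> x = x"
  shows "layers \<phi> W (\<lambda>_. mat 1) (\<lambda>_ _. mat 1) i (\<chi> j. x) = (\<chi> j. x)"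
proof (induction i)
  case (Suc i)
  have "attn_mean W' (\<chi> j. x) j = x" for W' and j :: 'b
    by (simp add: attn_mean_def wmean_def sum_softmax flip: scaleR_left.sum)
  thus ?case using assms by (simp add: parallel_mlp_def attn_nth Suc)
qed simp

text \<open>A general target \<open>r\<close> covers both signs, \<open>r = c\<close> and
  \<open>r = - c\<close>.\<close>

lemma TF_attains:
  fixes \<Gamma> c r :: real
  assumes "\<Gamma> > 0" "\<bar>r\<bar> \<le> c"
  shows "\<exists>(H :: (real^'d)^'m) W V M S. admissible \<Gamma> c L H W V M \<and> valid_input S \<and> TF \<phi> L H W V M S = r"
proof -
  \<comment> \<open>A standard basis vector is a unit vector with nonnegative coordinates, so both
    activations fix it.\<close>
  define x :: "real^'d" where "x = axis undefined 1"
  have x: "act \<phi> x = x" "norm x = 1"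
    by (cases \<phi>; simp add: x_def act_def vec_eq_iff axis_def) (simp add: x_def norm_axis_1)
  \<comment> \<open>Each of the \<open>CARD('m)\<close> final tokens equals \<open>x\<close> and
    contributes \<open>r / CARD('m)\<close>; the sign of \<open>r\<close> is carried by
    \<open>H\<close>.\<close>
  define H :: "(real^'d)^'m" where "H = (\<chi> j. (r / CARD('m)) *\<^sub>R x)"
  have "mat_norm (mat 1 :: real^'d^'d) \<le> 1" "mat_norm (0 :: real^'d^'d) \<le> \<Gamma> / 2"
    unfolding mat_norm_def using \<open>\<Gamma> > 0\<close> by - (rule onorm_le, simp)+
  moreover have "norm_2_inf H \<le> c / CARD('m)"
    unfolding norm_2_inf_def H_def using assms x by (auto simp: divide_right_mono)
  ultimately have "admissible \<Gamma> c L H (\<lambda>_. 0) (\<lambda>_. mat 1) (\<lambda>_ _. mat 1)"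
    by (simp add: admissible_def)
  moreover have "valid_input ((\<chi> j. x) :: (real^'d)^'m)" using x by (simp add: valid_input_def)
  moreover have "TF \<phi> L H (\<lambda>_. 0) (\<lambda>_. mat 1) (\<lambda>_ _. mat 1) (\<chi> j. x) = r"
    using x by (simp add: TF_def layers_const H_def power2_norm_eq_inner[symmetric])
  ultimately show ?thesis by blast
qed

theorem theorem4:
  fixes \<Gamma> c :: real and L :: nat and \<phi> :: activation
  assumes "\<Gamma> > 0" and "c > 0"
  shows
    "(\<exists>(H :: (real^'d)^'m) W V M S. admissible \<Gamma> c L H W V M \<and> valid_input S
         \<and> TF \<phi> L H W V M S = c)
   \<and> (\<exists>(H :: (real^'d)^'m) W V M S. admissible \<Gamma> c L H W V M \<and> valid_input S
         \<and> TF \<phi> L H W V M S = - c)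
   \<and> (\<forall>(H :: (real^'d)^'m) W V M S S'. admissible \<Gamma> c L H W V M \<longrightarrow>
         valid_input S \<longrightarrow> valid_input S' \<longrightarrow>
         \<bar>TF \<phi> L H W V M S - TF \<phi> L H W V M S'\<bar>
           \<le> c / real CARD('m) * ((1 + \<Gamma>) * exp \<Gamma>) ^ L * norm_2_1 (S - S'))"
  using assms by (intro conjI TF_attains allI impI TF_lipschitz) auto

end
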